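(* For every $\beta>0$, the price of anarchy of the stateless mean field game with exponential discounting $u(r,t)=re^{-\beta t}$ is infinite, i.e., $$\sup\Big\{\frac{\mathrm{SW}(\boldsymbol\mu^* )}{\mathrm{SW}(\boldsymbol\mu^\dagger)}\ \Big|\ \boldsymbol\mu^*\in\mathcal O(\mathcal G),\ \boldsymbol\mu^\dagger\in\mathcal S(\mathcal G)\Big\}=\infty,$$ where the supremum is over all instances $\mathcal G=(m,A,\boldsymbol r,\boldsymbol\tau,u)$ with this $u$ and with continuous and rate monotonous $\boldsymbol\tau$.
   Context: Game data: a total mass $m>0$ of nonatomic agents; a finite action set $A=\{1,\dots,n\}$, $n\ge2$; rewards $\boldsymbol r=(r_i)_{i\in A}$, $r_i>0$; for $s>0$ put $\mathcal U_s(A)=\{\boldsymbol\mu\in\mathbb R_{\ge0}^n\mid\sum_{i\in A}\mu_i=s\}$; sojourn-time functions $\tau_i:\bigcup_{s>0}\mathcal U_s(A)\to(0,\infty)$, $\boldsymbol\tau=(\tau_i)_{i\in A}$; a utility function $u(r,t)$ (present value of reward $r$ received at time $t$). The action rates are $x_i(\boldsymbol\mu)=\mu_i/\tau_i(\boldsymbol\mu)$. Continuous and rate monotonous: $\boldsymbol\tau$ is continuous on each $\mathcal U_s(A)$, and for all $\boldsymbol\mu,\boldsymbol\mu'\in\bigcup_{s>0}\mathcal U_s(A)$ and all $i\in A$, $x_i(\boldsymbol\mu)<x_i(\boldsymbol\mu')$ implies $\tau_i(\boldsymbol\mu)\le\tau_i(\boldsymbol\mu')$. Strategies: $\mathcal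 P(A)$ is the set of probability vectors on $A$. A strategy is a sequence $\boldsymbol\sigma=(\sigma_k)_{k\ge1}\in\mathcal P(A)^{\mathbb N}$; the $k$th action $a_k$ is drawn from $\sigma_k$, independently over $k$. It is stationary if $\sigma_k$ does not depend on $k$ (then identified with an element of $\mathcal P(A)$). Given a vector of sojourn times $\boldsymbol\tau=(\tau_i)_{i\in A}$, the expected total utility is $$V(\boldsymbol\sigma,\boldsymbol\tau)=\mathbb E_{\boldsymbol\sigma}\Big[\sum_{k=1}^\infty u\Big(r_{a_k},\sum_{j=1}^k\tau_{a_j}\Big)\Big].$$ Stationary equilibrium: a mass distribution $\boldsymbol\mu^\dagger\in\mathcal U_m(A)$ for which there is $\sigma^\dagger\in\mathcal P(A)$ such that (a) $\mu_i^\dagger=\theta\,\sigma^\dagger(i)\,\tau_i(\boldsymbol\mu^\dagger)$ for all $i\in A$, for some normalizing constant $\theta$, and (b) $V(\sigma^\dagger,\boldsymbol\tau(\boldsymbol\mu^\dagger))=\sup_{\boldsymbol\sigma\in\mathcal P(A)^{\mathbb N}}V(\boldsymbol\sigma,\boldsymbol\tau(\boldsymbol\mu^\dagger))$. $\mathcal S(\mathcal G)$ is the set of stationary equilibria. Social welfare: $\mathrm{SW}(\boldsymbol\mu)=\sum_{i\in A}r_ix_i(\boldsymbol\mu)$, and $\mathcal O(\mathcal G)=\arg\max\{\mathrm{SW}(\boldsymbol\mu)\mid\boldsymbol\mu\in\bigcup_{0<m'\le m}\mathcal U_{m'}(A)\}$. *)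

theory Defs
  imports "HOL-Probability.Probability"
begin

text \<open>
  A vector indexed by a finite action set \<open>A\<close> is a function \<open>nat \<Rightarrow> real\<close>. Mass distributions
  are required to vanish outside \<open>A\<close>, so that \<open>\<U> A s\<close> with the product topology of
  \<open>nat \<Rightarrow> real\<close> is homeomorphic to the corresponding simplex in Euclidean space. All other
  vectors (rewards, sojourn times) are arbitrary outside \<open>A\<close>.
\<close>

record mf_game =
  mass :: real
  num_actions :: nat
  reward :: "nat \<Rightarrow> real"
  sojourn :: "(nat \<Rightarrow> real) \<Rightarrow> nat \<Rightarrow> real"
  utility :: "real \<Rightarrow> real \<Rightarrow> real"

definition actions :: "mf_game \<Rightarrow> nat set" where
  "actions G = {1..num_actions G}"

definition \<U> :: "nat set \<Rightarrow> real \<Rightarrow> (nat \<Rightarrow> real) set" where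
  "\<U> A s = {\<mu>. (\<forall>i\<in>A. 0 \<le> \<mu> i) \<and> (\<forall>i. i \<notin> A \<longrightarrow> \<mu> i = 0) \<and> (\<Sum>i\<in>A. \<mu> i) = s}"

definition mf_game :: "mf_game \<Rightarrow> bool" where
  "mf_game G \<longleftrightarrow>
     0 < mass G \<and> 2 \<le> num_actions G \<and>
     (\<forall>i\<in>actions G. 0 < reward G i) \<and>
     (\<forall>s>0. \<forall>\<mu>\<in>\<U> (actions G) s. \<forall>i\<in>actions G. 0 < sojourn G \<mu> i)"

definition action_rate :: "mf_game \<Rightarrow> (nat \<Rightarrow> real) \<Rightarrow> nat \<Rightarrow> real" where
  "action_rate G \<mu> i = \<mu> i / sojourn G \<mu> i"

definition continuous_sojourn :: "mf_game \<Rightarrow> bool" where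
  "continuous_sojourn G \<longleftrightarrow>
     (\<forall>s>0. \<forall>i\<in>actions G. continuous_on (\<U> (actions G) s) (\<lambda>\<mu>. sojourn G \<mu> i))"

definition rate_monotonous :: "mf_game \<Rightarrow> bool" where
  "rate_monotonous G \<longleftrightarrow>
     (\<forall>\<mu>\<in>(\<Union>s\<in>{0<..}. \<U> (actions G) s). \<forall>\<mu>'\<in>(\<Union>s\<in>{0<..}. \<U> (actions G) s). \<forall>i\<in>actions G.
        action_rate G \<mu> i < action_rate G \<mu>' i \<longrightarrow> sojourn G \<mu> i \<le> sojourn G \<mu>' i)"

definition prob_vectors :: "nat set \<Rightarrow> nat pmf set" where
  "prob_vectors A = {p. set_pmf p \<subseteq> A}"

text \<open>
  Action sequences are indexed from \<open>0\<close>: \<open>\<sigma> k\<close> and \<open>a k\<close> are the distribution and the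
  outcome of the \<open>(k + 1)\<close>-st draw. For \<open>u r t = r * exp (- \<beta> * t)\<close> with \<open>\<beta> > 0\<close> and
  positive rewards and sojourn times, the series is almost surely bounded by a convergent
  geometric series, so neither \<open>suminf\<close> nor the Bochner integral takes a default value.
\<close>

definition expected_utility ::
  "(real \<Rightarrow> real \<Rightarrow> real) \<Rightarrow> (nat \<Rightarrow> real) \<Rightarrow> (nat \<Rightarrow> nat pmf) \<Rightarrow> (nat \<Rightarrow> real) \<Rightarrow> real" where
  "expected_utility u r \<sigma> t =
     (\<integral>a. (\<Sum>k. u (r (a k)) (\<Sum>j\<le>k. t (a j))) \<partial>(\<Pi>\<^sub>M k\<in>UNIV. measure_pmf (\<sigma> k)))"

definition stationary_equilibria :: "mf_game \<Rightarrow> (nat \<Rightarrow> real) set" where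
  "stationary_equilibria G = {\<mu> \<in> \<U> (actions G) (mass G).
     \<exists>\<sigma>\<in>prob_vectors (actions G).
       (\<exists>\<theta>. \<forall>i\<in>actions G. \<mu> i = \<theta> * pmf \<sigma> i * sojourn G \<mu> i) \<and>
       ereal (expected_utility (utility G) (reward G) (\<lambda>k. \<sigma>) (sojourn G \<mu>)) =
         (SUP \<rho>\<in>{\<rho>. \<forall>k. \<rho> k \<in> prob_vectors (actions G)}.
            ereal (expected_utility (utility G) (reward G) \<rho> (sojourn G \<mu>)))}"

definition social_welfare :: "mf_game \<Rightarrow> (nat \<Rightarrow> real) \<Rightarrow> real" where
  "social_welfare G \<mu> = (\<Sum>i\<in>actions G. reward G i * action_rate G \<mu> i)"

definition social_optima :: "mf_game \<Rightarrow> (nat \<Rightarrow> real) set" where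
  "social_optima G =
     {\<mu>. is_arg_max (social_welfare G) (\<lambda>\<nu>. \<nu> \<in> (\<Union>s\<in>{0<..mass G}. \<U> (actions G) s)) \<mu>}"

end

theory Submission
  imports Defs "HOL-Real_Asymp.Real_Asymp"
begin

text \<open>
  Constant sojourn times suffice. If \<open>r\<^sub>i = exp (\<beta> * \<tau>\<^sub>i) - 1\<close> for every action, then the discounted
  utility of any sequence of actions telescopes to \<open>1\<close>, so all strategies are optimal and playing
  only the short action is a stationary equilibrium. With sojourn times \<open>1\<close> and \<open>T\<close> and unit mass,
  this equilibrium has welfare \<open>exp \<beta> - 1\<close>, while putting all mass on the long action yields
  \<open>(exp (\<beta> * T) - 1) / T\<close>, which is unbounded in \<open>T\<close>.
\<close>

text \<open>A reward \<open>exp (\<beta> * t k) - 1\<close> paid at the end of an action is worth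
  exactly the drop of the discount factor during that action, so the series telescopes. Sojourn
  times bounded away from 0 make the factor vanish in the limit.\<close>

lemma discounted_telescope_sums:
  fixes t :: "nat \<Rightarrow> real"
  assumes "0 < \<beta>" "0 < \<epsilon>" and t: "\<And>k. \<epsilon> \<le> t k"
  shows "(\<lambda>k. (exp (\<beta> * t k) - 1) * exp (- \<beta> * (\<Sum>j\<le>k. t j))) sums 1"
proof -
  \<comment> \<open>Discount factor at the start of action \<open>k\<close>, hence the strict bound
    \<open>j<k\<close>; the reward of action \<open>k\<close> is discounted by
    \<open>D (Suc k)\<close>.\<close>
  define D where "D k = exp (- \<beta> * (\<Sum>j<k. t j))" for k
  have "D k \<le> exp (- \<beta> * \<epsilon>) ^ k" for k
  proof -
    have "real k * \<epsilon> \<le> (\<Sum>j<k. t j)"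
      using sum_bounded_below[of "{..<k}" \<epsilon> t] t by simp
    then have "\<beta> * (real k * \<epsilon>) \<le> \<beta> * (\<Sum>j<k. t j)"
      using \<open>0 < \<beta>\<close> by simp
    then show ?thesis
      by (simp add: D_def mult_ac flip: exp_of_nat_mult)
  qed
  moreover have "(\<lambda>k. exp (- \<beta> * \<epsilon>) ^ k) \<longlonglongrightarrow> 0"
    using assms by (intro LIMSEQ_realpow_zero) auto
  ultimately have "D \<longlonglongrightarrow> 0"
    by (intro tendsto_sandwich[of "\<lambda>_. 0" D sequentially "\<lambda>k. exp (- \<beta> * \<epsilon>) ^ k" 0])
      (auto simp: D_def)
  from telescope_sums'[OF this] have "(\<lambda>k. D k - D (Suc k)) sums 1"
    by (simp add: D_def)
  moreover have "D k - D (Suc k) = (exp (\<beta> * t k) - 1) * exp (- \<beta> * (\<Sum>j\<le>k. t j))" for k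
    by (simp add: D_def lessThan_Suc_atMost[symmetric] algebra_simps flip: exp_add)
  ultimately show ?thesis by simp
qed

text \<open>The integrand is 1 at every sequence \<open>a\<close>, so the integral is the total mass
  of a probability measure. As \<open>a\<close> ranges over all sequences of naturals,
  \<open>t\<close> is bounded below at every index.\<close>

lemma expected_utility_indifferent:
  assumes "0 < \<beta>" "0 < \<epsilon>" "\<And>i. \<epsilon> \<le> t i"
  shows "expected_utility (\<lambda>r t. r * exp (- \<beta> * t)) (\<lambda>i. exp (\<beta> * t i) - 1) \<sigma> t = 1"
proof -
  interpret prob_space "\<Pi>\<^sub>M k\<in>UNIV. measure_pmf (\<sigma> k)"
    by (intro prob_space_PiM prob_space_measure_pmf)
  have "(\<Sum>k. (exp (\<beta> * t (a k)) - 1) * exp (- \<beta> * (\<Sum>j\<le>k. t (a j)))) = 1" for a :: "nat \<Rightarrow> nat"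
    using discounted_telescope_sums[OF assms(1,2), of "\<lambda>k. t (a k)"] assms(3) by (simp add: sums_iff)
  then show ?thesis
    by (simp add: expected_utility_def prob_space)
qed

context
  fixes \<beta> T :: real
begin

text \<open>Every index other than 1 gets \<open>T\<close>, so \<open>min 1 T\<close> is a lower
  bound on all naturals, not only on the two actions.\<close>

definition two_action_sojourn :: "nat \<Rightarrow> real" where
  "two_action_sojourn i = (if i = 1 then 1 else T)"

definition two_action_game :: mf_game where
  "two_action_game = \<lparr>mass = 1, num_actions = 2,
     reward = \<lambda>i. exp (\<beta> * two_action_sojourn i) - 1,
     sojourn = \<lambda>\<mu>. two_action_sojourn, utility = \<lambda>r t. r * exp (- \<beta> * t)\<rparr>"

lemma actions_two_action_game: "actions two_action_game = {1, 2}"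
  by (auto simp: actions_def two_action_game_def)

lemma social_welfare_two_action_game:
  "social_welfare two_action_game \<mu> = (exp \<beta> - 1) * \<mu> 1 + (exp (\<beta> * T) - 1) / T * \<mu> 2"
  by (simp add: social_welfare_def actions_two_action_game action_rate_def)
    (simp add: two_action_game_def two_action_sojourn_def)

lemma concentrated_in_\<U>:
  "finite A \<Longrightarrow> i \<in> A \<Longrightarrow> 0 \<le> s \<Longrightarrow> (\<lambda>j. if j = i then s else 0) \<in> \<U> A s"
  by (auto simp: \<U>_def)

lemma mf_game_two_action_game: "0 < \<beta> \<Longrightarrow> 0 < T \<Longrightarrow> mf_game two_action_game"
  by (simp add: mf_game_def actions_two_action_game)
    (simp add: two_action_game_def two_action_sojourn_def)

lemma utility_two_action_game: "utility two_action_game = (\<lambda>r t. r * exp (- \<beta> * t))"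
  by (simp add: two_action_game_def)

lemma continuous_sojourn_two_action_game: "continuous_sojourn two_action_game"
  by (simp add: continuous_sojourn_def two_action_game_def)

lemma rate_monotonous_two_action_game: "rate_monotonous two_action_game"
  by (simp add: rate_monotonous_def two_action_game_def)

lemma stationary_equilibrium_two_action_game:
  assumes "0 < \<beta>" "0 < T"
  shows "(\<lambda>j. if j = 1 then 1 else 0) \<in> stationary_equilibria two_action_game"
proof -
  let ?G = two_action_game
  let ?\<mu> = "\<lambda>j::nat. if j = 1 then 1 else 0 :: real"
  have V: "expected_utility (utility ?G) (reward ?G) \<rho> (sojourn ?G \<mu>) = 1" for \<rho> \<mu>
    using expected_utility_indifferent[of \<beta> "min 1 T" two_action_sojourn] assms
    by (simp add: two_action_game_def two_action_sojourn_def)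
  have pure: "return_pmf 1 \<in> prob_vectors (actions ?G)"
    by (simp add: prob_vectors_def actions_two_action_game)
  \<comment> \<open>By \<open>V\<close> the supremum is over constant values 1; it equals 1 only
    because some strategy exists, the empty supremum in \<open>ereal\<close> being
    -\<infinity>.\<close>
  then have "{\<rho>. \<forall>k::nat. \<rho> k \<in> prob_vectors (actions ?G)} \<noteq> {}"
    by (auto intro: exI[of _ "\<lambda>_. return_pmf 1"])
  moreover have "?\<mu> \<in> \<U> (actions ?G) (mass ?G)"
    using concentrated_in_\<U>[of "{1, 2}" 1 1]
    by (simp add: actions_two_action_game) (simp add: two_action_game_def)
  moreover have "\<exists>\<theta>. \<forall>i\<in>actions ?G. ?\<mu> i = \<theta> * pmf (return_pmf 1) i * sojourn ?G ?\<mu> i"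
    \<comment> \<open>Action 1 carries mass 1, probability 1 and sojourn time 1, so \<theta> =
      1.\<close>
    by (intro exI[of _ 1])
      (simp add: actions_two_action_game, simp add: two_action_game_def two_action_sojourn_def)
  ultimately show ?thesis
    unfolding stationary_equilibria_def V using pure
    by (intro CollectI conjI bexI[of _ "return_pmf 1"]) simp_all
qed

text \<open>Welfare is linear in the masses, and \<open>le\<close> says that a unit of mass earns at
  least as much on action 2 as on action 1.\<close>

lemma social_optimum_two_action_game:
  assumes "0 < \<beta>" and le: "exp \<beta> - 1 \<le> (exp (\<beta> * T) - 1) / T"
  shows "(\<lambda>j. if j = 2 then 1 else 0) \<in> social_optima two_action_game"
proof -
  let ?G = two_action_game
  let ?F = "\<Union>s\<in>{0<..mass ?G}. \<U> (actions ?G) s"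
  let ?w = "(exp (\<beta> * T) - 1) / T"
  let ?\<mu> = "\<lambda>j::nat. if j = 2 then 1 else 0 :: real"
  have "social_welfare ?G \<nu> \<le> social_welfare ?G ?\<mu>" if "\<nu> \<in> ?F" for \<nu>
  proof -
    have nonneg: "0 \<le> \<nu> 1" "0 \<le> \<nu> 2" and total: "\<nu> 1 + \<nu> 2 \<le> 1"
      using that by (auto simp: \<U>_def actions_two_action_game) (auto simp: two_action_game_def)
    \<comment> \<open>Feasible total masses may be below 1; a nonnegative rate makes using the full
      mass optimal.\<close>
    have "0 \<le> ?w"
      using le \<open>0 < \<beta>\<close> one_le_exp_iff[of \<beta>] by linarith
    have "(exp \<beta> - 1) * \<nu> 1 + ?w * \<nu> 2 \<le> ?w * (\<nu> 1 + \<nu> 2)"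
      using mult_right_mono[OF le nonneg(1)] by (simp add: distrib_left)
    also have "\<dots> \<le> ?w"
      using mult_left_mono[OF total \<open>0 \<le> ?w\<close>] by simp
    finally show ?thesis
      by (simp add: social_welfare_two_action_game)
  qed
  moreover have "?\<mu> \<in> ?F"
    using concentrated_in_\<U>[of "{1, 2}" 2 1]
    by (intro UN_I[of 1]) (simp_all add: actions_two_action_game, simp_all add: two_action_game_def)
  ultimately show ?thesis
    by (auto simp: social_optima_def is_arg_max_linorder)
qed

end

theorem corollary1:
  fixes \<beta> :: real
  assumes "0 < \<beta>"
  shows "Sup {ereal (social_welfare G \<mu>opt / social_welfare G \<mu>eq) | G \<mu>opt \<mu>eq.
            mf_game G \<and> utility G = (\<lambda>r t. r * exp (- \<beta> * t)) \<and>
            continuous_sojourn G \<and> rate_monotonous G \<and>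
            \<mu>opt \<in> social_optima G \<and> \<mu>eq \<in> stationary_equilibria G} = \<infinity>"
    (is "Sup ?S = \<infinity>")
proof (rule ereal_top)
  fix B :: real
  have "filterlim (\<lambda>T. (exp (\<beta> * T) - 1) / T) at_top at_top"
    using assms by real_asymp
  then have "\<forall>\<^sub>F T in at_top. C \<le> (exp (\<beta> * T) - 1) / T" for C
    by (simp only: filterlim_at_top)
  \<comment> \<open>The second condition makes the long action optimal; the third pushes the welfare
    ratio up to the given \<open>B\<close>.\<close>
  then have "\<forall>\<^sub>F T in at_top. 0 < T \<and> exp \<beta> - 1 \<le> (exp (\<beta> * T) - 1) / T \<and>
      B * (exp \<beta> - 1) \<le> (exp (\<beta> * T) - 1) / T"
    by (intro eventually_conj eventually_gt_at_top)
  then obtain T where T: "0 < T" "exp \<beta> - 1 \<le> (exp (\<beta> * T) - 1) / T"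
      "B * (exp \<beta> - 1) \<le> (exp (\<beta> * T) - 1) / T"
    using eventually_happens'[OF trivial_limit_at_top_linorder] by blast
  let ?G = "two_action_game \<beta> T"
  let ?ratio = "social_welfare ?G (\<lambda>j. if j = 2 then 1 else 0) /
    social_welfare ?G (\<lambda>j. if j = 1 then 1 else 0)"
  have "ereal ?ratio \<in> ?S"
    using mf_game_two_action_game[OF assms T(1)] continuous_sojourn_two_action_game
      rate_monotonous_two_action_game social_optimum_two_action_game[OF assms T(2)]
      stationary_equilibrium_two_action_game[OF assms T(1)]
      utility_two_action_game by blast
  moreover have "B \<le> ?ratio"
    using T assms by (simp add: social_welfare_two_action_game pos_le_divide_eq mult_ac)
  ultimately show "ereal B \<le> Sup ?S"
    by (meson Sup_upper2 ereal_less_eq(3))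
qed

end
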